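(* Let $(\Omega,\rho)$ be a Euclidean polynomial space of dimension $n$. Suppose there exists an injection $\tau:\Omega\to\mathbb{R}^m$ that is affinely compatible with $\rho$, where $m\ge n$. Then for each $r\ge0$, \[ \mathrm{Pol}(\Omega,r)=\{f\circ\tau:\Omega\to\mathbb{R}\mid f\in\mathbb{R}_r[x_1,\ldots,x_m]\}. \]
   Context: Let $\Omega$ be a nonempty set and $\rho:\Omega\times\Omega\to\mathbb{R}$ a function (the separation function); for $a\in\Omega$ write $\rho_a(\eta)=\rho(a,\eta)$. Let $\mathrm{Pol}(\Omega,0)$ be the space of constant real functions on $\Omega$, $\mathrm{Pol}(\Omega,1)=\mathrm{Span}_{\mathbb{R}}\{f\circ\rho_a : a\in\Omega,\ f\in\mathbb{R}[x],\ \deg f\le 1\}$, and inductively $\mathrm{Pol}(\Omega,r+1)=\mathrm{Span}_{\mathbb{R}}\{gh : g\in\mathrm{Pol}(\Omega,r),\ h\in\mathrm{Pol}(\Omega,1)\}$; $\mathrm{Pol}(\Omega)=\bigcup_{r\ge0}\mathrm{Pol}(\Omega,r)$. $(\Omega,\rho)$ together with an inner product $\langle\cdot,\cdot\rangle$ on $\mathrm{Pol}(\Omega)$ is a polynomial space if: (i) $\rho(x,y)=\rho(y,x)$; (ii) each $\mathrm{Pol}(\Omega,r)$ is finite-dimensional; (iii) $\langle f,g\rangle=\langle 1,fg\rangle$; (iv) if $f\ge 0$ pointwise then $\langle1,f\rangle\ge0$, with equality iff $f=0$. The dimension of the polynomial space is $\dim\mathrm{Pol}(\Omega,1)-1$.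 Two separation functions $\rho,\sigma$ are affinely equivalent if $\rho=a\sigma+b$ for some $a\neq0$, $b\in\mathbb{R}$. The polynomial space is Euclidean if there exist an integer $d$, an injection $\tau_0:\Omega\to\mathbb{R}^d$ and a separation function $\rho'$ affinely equivalent to $\rho$ with $\rho'(x,y)=(\tau_0(x),\tau_0(y))$ (standard inner product) for all $x,y$. An injection $\tau:\Omega\to\mathbb{R}^m$ is affinely compatible with $\rho$ if there exist $a\ne0$, $b\in\mathbb{R}$ with $\rho(x,y)=a(\tau(x),\tau(y))+b$ for all $x,y$. $\mathbb{R}_r[x_1,\ldots,x_m]$ is the space of real polynomials of total degree at most $r$. *)

theory Defs
  imports
    "HOL-Library.Function_Algebras"
    "HOL-Library.Poly_Mapping"
    "HOL-Computational_Algebra.Polynomial"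
    "Jordan_Normal_Form.Matrix"
begin

text \<open>
  The nonempty set \<open>\<Omega>\<close> is the type \<open>'a\<close>. The real vector space of all functions
  \<open>'a \<Rightarrow> real\<close> carries the pointwise operations; \<open>fun_space.span\<close> and \<open>fun_space.dim\<close>
  are linear span and dimension in it.
\<close>

definition fun_scale :: "real \<Rightarrow> ('a \<Rightarrow> real) \<Rightarrow> 'a \<Rightarrow> real" where
  "fun_scale c f = (\<lambda>x. c * f x)"

interpretation fun_space: vector_space fun_scale
  by unfold_locales (auto simp: fun_scale_def fun_eq_iff algebra_simps)

definition finite_dimensional :: "('a \<Rightarrow> real) set \<Rightarrow> bool" where
  "finite_dimensional V \<longleftrightarrow> (\<exists>B. finite B \<and> fun_space.span B = V)"

fun Pol :: "('a \<Rightarrow> 'a \<Rightarrow> real) \<Rightarrow> nat \<Rightarrow> ('a \<Rightarrow> real) set" where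
  "Pol \<rho> 0 = {f. \<exists>c. f = (\<lambda>_. c)}"
| "Pol \<rho> (Suc 0) = fun_space.span {poly f \<circ> \<rho> a | a f. degree f \<le> 1}"
| "Pol \<rho> (Suc (Suc r)) = fun_space.span {g * h | g h. g \<in> Pol \<rho> (Suc r) \<and> h \<in> Pol \<rho> (Suc 0)}"

definition Pol_all :: "('a \<Rightarrow> 'a \<Rightarrow> real) \<Rightarrow> ('a \<Rightarrow> real) set" where
  "Pol_all \<rho> = (\<Union>r. Pol \<rho> r)"

text \<open>Only the values of \<open>ip\<close> on \<open>V \<times> V\<close> matter.\<close>

definition inner_product_on ::
  "('a \<Rightarrow> real) set \<Rightarrow> (('a \<Rightarrow> real) \<Rightarrow> ('a \<Rightarrow> real) \<Rightarrow> real) \<Rightarrow> bool" where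
  "inner_product_on V ip \<longleftrightarrow>
     (\<forall>f\<in>V. \<forall>g\<in>V. ip f g = ip g f) \<and>
     (\<forall>f\<in>V. \<forall>g\<in>V. \<forall>h\<in>V. ip (f + g) h = ip f h + ip g h) \<and>
     (\<forall>c. \<forall>f\<in>V. \<forall>g\<in>V. ip (fun_scale c f) g = c * ip f g) \<and>
     (\<forall>f\<in>V. 0 \<le> ip f f \<and> (ip f f = 0 \<longleftrightarrow> f = 0))"

locale polynomial_space =
  fixes \<rho> :: "'a \<Rightarrow> 'a \<Rightarrow> real"
    and ip :: "('a \<Rightarrow> real) \<Rightarrow> ('a \<Rightarrow> real) \<Rightarrow> real"
  assumes inner_product: "inner_product_on (Pol_all \<rho>) ip"
    and sym: "\<rho> x y = \<rho> y x"
    and finite_dim: "finite_dimensional (Pol \<rho> r)"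
    and ip_mult: "f \<in> Pol_all \<rho> \<Longrightarrow> g \<in> Pol_all \<rho> \<Longrightarrow> ip f g = ip 1 (f * g)"
    and ip_nonneg: "f \<in> Pol_all \<rho> \<Longrightarrow> (\<forall>x. 0 \<le> f x) \<Longrightarrow> 0 \<le> ip 1 f"
    and ip_eq_0: "f \<in> Pol_all \<rho> \<Longrightarrow> (\<forall>x. 0 \<le> f x) \<Longrightarrow> ip 1 f = 0 \<longleftrightarrow> f = 0"

text \<open>The truncated subtraction is harmless: \<open>Pol \<rho> 1\<close> contains the nonzero constants.\<close>

definition space_dim :: "('a \<Rightarrow> 'a \<Rightarrow> real) \<Rightarrow> nat" where
  "space_dim \<rho> = fun_space.dim (Pol \<rho> 1) - 1"

definition affinely_equivalent :: "('a \<Rightarrow> 'a \<Rightarrow> real) \<Rightarrow> ('a \<Rightarrow> 'a \<Rightarrow> real) \<Rightarrow> bool" where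
  "affinely_equivalent \<rho> \<sigma> \<longleftrightarrow> (\<exists>a b. a \<noteq> 0 \<and> (\<forall>x y. \<rho> x y = a * \<sigma> x y + b))"

text \<open>\<open>\<real>\<^sup>d\<close> is \<open>carrier_vec d\<close>, which includes the case \<open>d = 0\<close>.\<close>

definition euclidean :: "('a \<Rightarrow> 'a \<Rightarrow> real) \<Rightarrow> bool" where
  "euclidean \<rho> \<longleftrightarrow>
     (\<exists>(d::nat) (\<tau>\<^sub>0 :: 'a \<Rightarrow> real vec) \<rho>'.
        \<tau>\<^sub>0 \<in> UNIV \<rightarrow> carrier_vec d \<and> inj \<tau>\<^sub>0 \<and> affinely_equivalent \<rho>' \<rho> \<and>
        (\<forall>x y. \<rho>' x y = \<tau>\<^sub>0 x \<bullet> \<tau>\<^sub>0 y))"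

definition affinely_compatible :: "('a \<Rightarrow> real vec) \<Rightarrow> ('a \<Rightarrow> 'a \<Rightarrow> real) \<Rightarrow> bool" where
  "affinely_compatible \<tau> \<rho> \<longleftrightarrow> (\<exists>a b. a \<noteq> 0 \<and> (\<forall>x y. \<rho> x y = a * (\<tau> x \<bullet> \<tau> y) + b))"

text \<open>
  A multivariate polynomial is a finitely supported map from exponent vectors (themselves
  finitely supported maps from variable indices to exponents) to coefficients. The variables
  \<open>x\<^sub>1, \<dots>, x\<^sub>m\<close> have indices \<open>0, \<dots>, m - 1\<close>.
\<close>

type_synonym mpoly = "(nat \<Rightarrow>\<^sub>0 nat) \<Rightarrow>\<^sub>0 real"

definition mdeg :: "(nat \<Rightarrow>\<^sub>0 nat) \<Rightarrow> nat" where
  "mdeg e = (\<Sum>i\<in>Poly_Mapping.keys e. Poly_Mapping.lookup e i)"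

definition mpolys :: "nat \<Rightarrow> nat \<Rightarrow> mpoly set" where
  "mpolys m r = {p. \<forall>e\<in>Poly_Mapping.keys p. Poly_Mapping.keys e \<subseteq> {..<m} \<and> mdeg e \<le> r}"

definition mpoly_eval :: "mpoly \<Rightarrow> real vec \<Rightarrow> real" where
  "mpoly_eval p v = (\<Sum>e\<in>Poly_Mapping.keys p.
     Poly_Mapping.lookup p e * (\<Prod>i\<in>Poly_Mapping.keys e. (v $ i) ^ Poly_Mapping.lookup e i))"

end

theory Submission
  imports Defs
begin

text \<open>
  Up to an affine change, \<open>\<rho>\<^sub>a\<close> is the linear form \<open>\<tau> a \<bullet> _\<close> restricted to \<open>\<tau>(\<Omega>)\<close>. Projecting
  a unit vector orthogonally onto the span of \<open>\<tau>(\<Omega>)\<close> does not change the linear form it induces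
  on \<open>\<tau>(\<Omega>)\<close>, so each coordinate of \<open>\<tau>\<close> is a linear combination of the forms \<open>\<tau> a \<bullet> _\<close>.
  Hence \<open>Pol \<rho> 1\<close> is spanned by \<open>1\<close> and the coordinates of \<open>\<tau>\<close>, and \<open>Pol \<rho> r\<close> is spanned
  by the monomials of degree at most \<open>r\<close> in these coordinates.
\<close>

section \<open>Orthogonal projection and the coordinates of \<open>\<tau>\<close>\<close>

lemma fun_scale_apply [simp]: "fun_scale c f x = c * f x"
  by (simp add: fun_scale_def)

lemma sum_fun_apply: "sum f A x = (\<Sum>i\<in>A. f i x)"
  for f :: "'i \<Rightarrow> 'a \<Rightarrow> real"
  by (induction A rule: infinite_finite_induct) auto

text \<open>Vectors are encoded as functions on \<open>nat\<close> so that spans and independence in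
  \<open>fun_space\<close> apply to them. The form sees only the first \<open>m\<close> entries, so
  on all such functions it is merely positive semidefinite.\<close>

definition coord_prod :: "nat \<Rightarrow> (nat \<Rightarrow> real) \<Rightarrow> (nat \<Rightarrow> real) \<Rightarrow> real" where
  "coord_prod m u v = (\<Sum>i<m. u i * v i)"

lemma coord_prod_diff_left: "coord_prod m (u - v) w = coord_prod m u w - coord_prod m v w"
  by (simp add: coord_prod_def algebra_simps sum_subtractf)

lemma coord_prod_add_left: "coord_prod m (u + v) w = coord_prod m u w + coord_prod m v w"
  by (simp add: coord_prod_def algebra_simps sum.distrib)

lemma coord_prod_scale_left: "coord_prod m (fun_scale c u) w = c * coord_prod m u w"
  by (simp add: coord_prod_def algebra_simps sum_distrib_left)

lemma coord_prod_commute: "coord_prod m u v = coord_prod m v u"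
  by (simp add: coord_prod_def mult.commute)

text \<open>A vanishing sum of squares kills the first \<open>m\<close> entries of \<open>u\<close>.
  This replaces definiteness in the projection argument.\<close>

lemma coord_prod_self_eq_0: "coord_prod m u u = 0 \<Longrightarrow> coord_prod m v u = 0"
  by (simp add: coord_prod_def sum_nonneg_eq_0_iff)

lemma coord_prod_span_eq_0:
  assumes "w \<in> fun_space.span B" "\<And>b. b \<in> B \<Longrightarrow> coord_prod m u b = 0"
  shows "coord_prod m u w = 0"
  using assms(1)
proof (induction rule: fun_space.span_induct_alt)
  case base
  show ?case by (simp add: coord_prod_def)
next
  case (step c b w)
  then show ?case
    using assms(2) by (metis coord_prod_add_left coord_prod_commute coord_prod_scale_left
        add_0 mult_zero_right)
qed

text \<open>A Gram-Schmidt step: the part \<open>q\<close> of the new vector \<open>b\<close>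
  orthogonal to \<open>B\<close> is split off, and the projection of \<open>u\<close> onto the span
  of \<open>B\<close> is corrected along \<open>q\<close>. The induction hypothesis serves both
  \<open>u\<close> and \<open>b\<close>, hence the generalization over \<open>u\<close>.\<close>

lemma orthogonal_projection_finite:
  assumes "finite B"
  shows "\<exists>w \<in> fun_space.span B. \<forall>b\<in>B. coord_prod m (u - w) b = 0"
  using assms
proof (induction B arbitrary: u rule: finite_induct)
  case empty
  show ?case by (rule bexI[OF _ fun_space.span_zero]) blast
next
  case (insert b B)
  obtain w where w: "w \<in> fun_space.span B" "\<And>x. x \<in> B \<Longrightarrow> coord_prod m (u - w) x = 0"
    using insert.IH by blast
  obtain z where z: "z \<in> fun_space.span B" "\<And>x. x \<in> B \<Longrightarrow> coord_prod m (b - z) x = 0"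
    using insert.IH by blast
  define q where "q = b - z"
  define c where "c = coord_prod m (u - w) q / coord_prod m q q"
  define w' where "w' = w + fun_scale c q"
  have uw': "u - w' = (u - w) - fun_scale c q"
    by (simp add: w'_def)
  have mono: "fun_space.span B \<subseteq> fun_space.span (insert b B)"
    by (intro fun_space.span_mono) auto
  have "w' \<in> fun_space.span (insert b B)"
    unfolding w'_def q_def using w(1) z(1) mono
    by (intro fun_space.span_add fun_space.span_scale fun_space.span_diff)
       (auto intro: fun_space.span_base)
  \<comment> \<open>Since \<open>q\<close> is orthogonal to \<open>B\<close>, correcting along it
    does not disturb the orthogonality already achieved.\<close>
  moreover have B0: "coord_prod m (u - w') x = 0" if "x \<in> B" for x
    using w(2)[OF that] z(2)[OF that]
    by (simp add: uw' coord_prod_diff_left coord_prod_scale_left q_def)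
  moreover have "coord_prod m (u - w') b = 0"
  proof -
    have "coord_prod m (u - w') z = 0"
      using coord_prod_span_eq_0[OF z(1)] B0 by blast
    moreover have "coord_prod m (u - w') q = 0"
      using coord_prod_self_eq_0[of m q "u - w"]
      by (cases "coord_prod m q q = 0")
         (simp_all add: uw' coord_prod_diff_left coord_prod_scale_left c_def)
    moreover have "b = q + z"
      by (simp add: q_def)
    ultimately show ?thesis
      by (metis coord_prod_add_left coord_prod_commute add_0)
  qed
  ultimately show ?case by blast
qed

text \<open>The set \<open>T\<close> may be infinite, but its members live on the first
  \<open>m\<close> indices and so lie in the span of \<open>m\<close> unit vectors. A maximal
  independent subset of \<open>T\<close> is therefore finite, and projecting onto its span
  suffices.\<close>

lemma orthogonal_projection:
  assumes "\<And>v i. v \<in> T \<Longrightarrow> i \<ge> m \<Longrightarrow> v i = 0"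
  shows "\<exists>w \<in> fun_space.span T. \<forall>v\<in>T. coord_prod m (u - w) v = 0"
proof -
  define E :: "(nat \<Rightarrow> real) set" where "E = (\<lambda>i j. if j = i then 1 else 0) ` {..<m}"
  have "T \<subseteq> fun_space.span E"
  proof
    fix v assume "v \<in> T"
    have "v = (\<Sum>i<m. fun_scale (v i) (\<lambda>j. if j = i then 1 else 0))"
    proof
      fix j
      have "(\<Sum>i<m. v i * (if j = i then 1 else 0)) = (if j < m then v j else 0)"
        by (simp add: if_distrib cong: if_cong)
      then show "v j = (\<Sum>i<m. fun_scale (v i) (\<lambda>j. if j = i then 1 else 0)) j"
        using assms[OF \<open>v \<in> T\<close>, of j] by (simp add: sum_fun_apply)
    qed
    also have "\<dots> \<in> fun_space.span E"
      by (intro fun_space.span_sum fun_space.span_scale fun_space.span_base) (auto simp: E_def)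
    finally show "v \<in> fun_space.span E" .
  qed
  moreover obtain B where B: "B \<subseteq> T" "fun_space.independent B" "T \<subseteq> fun_space.span B"
    using fun_space.maximal_independent_subset by blast
  moreover have "finite E"
    by (simp add: E_def)
  ultimately have "finite B"
    using fun_space.independent_span_bound[of E B] by blast
  then obtain w where w: "w \<in> fun_space.span B" "\<forall>b\<in>B. coord_prod m (u - w) b = 0"
    using orthogonal_projection_finite by blast
  then have "\<forall>v\<in>T. coord_prod m (u - w) v = 0"
    using coord_prod_span_eq_0 B(3) by blast
  then show ?thesis
    using w(1) fun_space.span_mono[OF B(1)] by blast
qed

lemma coordinate_in_span_products:
  fixes \<tau> :: "'a \<Rightarrow> real vec"
  assumes \<tau>: "\<tau> \<in> UNIV \<rightarrow> carrier_vec m" and "i < m"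
  shows "(\<lambda>x. \<tau> x $ i) \<in> fun_space.span (range (\<lambda>a x. \<tau> a \<bullet> \<tau> x))"
proof -
  \<comment> \<open>Padding by zeros: entries of a \<open>vec\<close> beyond its dimension are
    unspecified, whereas \<open>orthogonal_projection\<close> needs entries from \<open>m\<close> on
    to vanish.\<close>
  define g where "g = (\<lambda>x j. if j < m then \<tau> x $ j else 0)"
  define u :: "nat \<Rightarrow> real" where "u = (\<lambda>j. if j = i then 1 else 0)"
  let ?V = "fun_space.span (range (\<lambda>a x. \<tau> a \<bullet> \<tau> x))"
  have gg: "coord_prod m (g a) (g x) = \<tau> a \<bullet> \<tau> x" for a x
  proof -
    have "dim_vec (\<tau> x) = m" using \<tau> by (auto dest: funcset_mem carrier_vecD)
    then show ?thesis
      by (simp add: coord_prod_def g_def scalar_prod_def lessThan_atLeast0)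
  qed
  obtain w where w: "w \<in> fun_space.span (range g)"
      "\<forall>v\<in>range g. coord_prod m (u - w) v = 0"
  proof -
    have "v i = 0" if "v \<in> range g" "i \<ge> m" for v i
      using that by (auto simp: g_def)
    then show thesis
      using orthogonal_projection[of "range g" m u] that by blast
  qed
  have "(\<lambda>x. coord_prod m w (g x)) \<in> ?V"
    using w(1)
  proof (induction rule: fun_space.span_induct_alt)
    case base
    have "(\<lambda>x. coord_prod m 0 (g x)) = 0"
      by (auto simp: coord_prod_def)
    then show ?case by (simp only: fun_space.span_zero)
  next
    case (step c v w)
    then obtain a where "v = g a" by blast
    then have "(\<lambda>x. coord_prod m (fun_scale c v + w) (g x)) =
        fun_scale c (\<lambda>x. \<tau> a \<bullet> \<tau> x) + (\<lambda>x. coord_prod m w (g x))"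
      by (auto simp: coord_prod_add_left coord_prod_scale_left gg)
    moreover have "(\<lambda>x. \<tau> a \<bullet> \<tau> x) \<in> ?V"
      by (rule fun_space.span_base) auto
    ultimately show ?case
      using step.IH by (simp only: fun_space.span_add fun_space.span_scale)
  qed
  moreover have "coord_prod m w (g x) = \<tau> x $ i" for x
  proof -
    have "coord_prod m w (g x) = coord_prod m u (g x)"
      using w(2) by (simp add: coord_prod_diff_left)
    also have "\<dots> = \<tau> x $ i"
      using \<open>i < m\<close> by (simp add: coord_prod_def u_def g_def if_distrib if_distribR cong: if_cong)
    finally show ?thesis .
  qed
  ultimately show ?thesis by simp
qed

section \<open>Products of spans\<close>

text \<open>By bilinearity of multiplication, with one span induction per factor. It reduces the
  recursion for \<open>Pol\<close>, which multiplies whole spaces, to products of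
  generators.\<close>

lemma span_products_span:
  fixes A B :: "('a \<Rightarrow> real) set"
  shows "fun_space.span {g * h | g h. g \<in> fun_space.span A \<and> h \<in> fun_space.span B} =
    fun_space.span {g * h | g h. g \<in> A \<and> h \<in> B}" (is "?L = ?R")
proof
  have left: "g * h \<in> ?R" if "g \<in> A" "h \<in> fun_space.span B" for g h
    using that(2)
  proof (induction rule: fun_space.span_induct_alt)
    case base
    show ?case by (simp only: mult_zero_left mult_zero_right fun_space.span_zero)
  next
    case (step c x y)
    have "g * (fun_scale c x + y) = fun_scale c (g * x) + g * y"
      by (auto simp: algebra_simps)
    moreover have "g * x \<in> ?R"
      using step that(1) by (intro fun_space.span_base) auto
    ultimately show ?case
      using step.IH by (simp only: fun_space.span_add fun_space.span_scale)
  qed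
  have "g * h \<in> ?R" if "g \<in> fun_space.span A" "h \<in> fun_space.span B" for g h
    using that(1)
  proof (induction rule: fun_space.span_induct_alt)
    case base
    show ?case by (simp only: mult_zero_left mult_zero_right fun_space.span_zero)
  next
    case (step c x y)
    have "(fun_scale c x + y) * h = fun_scale c (x * h) + y * h"
      by (auto simp: algebra_simps)
    then show ?case
      using step left[OF _ that(2)] by (simp only: fun_space.span_add fun_space.span_scale)
  qed
  then show "?L \<subseteq> ?R"
    by (intro fun_space.span_minimal fun_space.subspace_span) auto
  show "?R \<subseteq> ?L"
    by (intro fun_space.span_mono) (blast intro: fun_space.span_base)
qed

section \<open>Exponent vectors and monomials\<close>

definition monomial_at :: "real vec \<Rightarrow> (nat \<Rightarrow>\<^sub>0 nat) \<Rightarrow> real" where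
  "monomial_at v e = (\<Prod>i\<in>Poly_Mapping.keys e. (v $ i) ^ Poly_Mapping.lookup e i)"

definition exponents :: "nat \<Rightarrow> nat \<Rightarrow> (nat \<Rightarrow>\<^sub>0 nat) set" where
  "exponents m r = {e. Poly_Mapping.keys e \<subseteq> {..<m} \<and> mdeg e \<le> r}"

definition monomials :: "('a \<Rightarrow> real vec) \<Rightarrow> nat \<Rightarrow> nat \<Rightarrow> ('a \<Rightarrow> real) set" where
  "monomials \<tau> m r = (\<lambda>e x. monomial_at (\<tau> x) e) ` exponents m r"

text \<open>The keys of \<open>e\<close>, \<open>f\<close> and \<open>e + f\<close> may differ.
  Extra indices have exponent 0, so all three degrees can be computed over one common index set;
  \<open>monomial_at_superset\<close> does the same for products.\<close>

lemma mdeg_superset: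
  "finite I \<Longrightarrow> Poly_Mapping.keys e \<subseteq> I \<Longrightarrow> mdeg e = (\<Sum>i\<in>I. Poly_Mapping.lookup e i)"
  unfolding mdeg_def by (rule sum.mono_neutral_left) (auto simp: in_keys_iff)

lemma monomial_at_superset:
  "finite I \<Longrightarrow> Poly_Mapping.keys e \<subseteq> I \<Longrightarrow>
    monomial_at v e = (\<Prod>i\<in>I. (v $ i) ^ Poly_Mapping.lookup e i)"
  unfolding monomial_at_def by (rule prod.mono_neutral_left) (auto simp: in_keys_iff)

lemma mdeg_add: "mdeg (e + f) = mdeg e + mdeg f"
  using Poly_Mapping.keys_add[of e f]
  by (simp add: mdeg_superset[of "Poly_Mapping.keys e \<union> Poly_Mapping.keys f"]
      lookup_add sum.distrib)

lemma monomial_at_add: "monomial_at v (e + f) = monomial_at v e * monomial_at v f"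
  using Poly_Mapping.keys_add[of e f]
  by (simp add: monomial_at_superset[of "Poly_Mapping.keys e \<union> Poly_Mapping.keys f"]
      lookup_add power_add prod.distrib)

lemma mdeg_zero [simp]: "mdeg 0 = 0"
  by (simp add: mdeg_def)

lemma mdeg_single [simp]: "mdeg (Poly_Mapping.single i k) = k"
  by (simp add: mdeg_def)

lemma monomial_at_zero [simp]: "monomial_at v 0 = 1"
  by (simp add: monomial_at_def)

lemma monomial_at_single [simp]: "monomial_at v (Poly_Mapping.single i k) = (v $ i) ^ k"
  by (simp add: monomial_at_def)

lemma mdeg_Suc_split:
  assumes "mdeg e = Suc r"
  obtains i f where "i \<in> Poly_Mapping.keys e" "e = f + Poly_Mapping.single i 1"
proof -
  obtain i where i: "i \<in> Poly_Mapping.keys e"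
    using assms by (cases "Poly_Mapping.keys e = {}") (auto simp: mdeg_def simp del: keys_eq_empty)
  then have "Poly_Mapping.lookup e i > 0"
    by (simp add: in_keys_iff)
  \<comment> \<open>Subtraction of exponents is truncated, but the exponent at \<open>i\<close> is
    positive, so adding the variable back restores \<open>e\<close>.\<close>
  then have "e = (e - Poly_Mapping.single i 1) + Poly_Mapping.single i 1"
    by (intro poly_mapping_eqI) (auto simp: lookup_add lookup_minus lookup_single when_def)
  then show thesis using i that by blast
qed

lemma exponents_0: "exponents m 0 = {0}"
proof -
  have "e = 0" if "mdeg e = 0" for e
    using that by (auto simp: mdeg_def in_keys_iff intro: poly_mapping_eqI)
  then show ?thesis by (auto simp: exponents_def)
qed

text \<open>Exponents are natural numbers, so no cancellation can occur in the sum.\<close>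

lemma keys_summand_subset:
  fixes e f :: "nat \<Rightarrow>\<^sub>0 nat"
  shows "Poly_Mapping.keys e \<subseteq> Poly_Mapping.keys (e + f)"
  by (auto simp: in_keys_iff lookup_add)

text \<open>An exponent of degree exactly \<open>Suc r\<close> loses one variable; one of lower
  degree is paired with 0, which also lies in \<open>exponents m 1\<close>.\<close>

lemma exponents_Suc:
  "exponents m (Suc r) = {e + f | e f. e \<in> exponents m r \<and> f \<in> exponents m 1}"
proof (intro Set.set_eqI iffI)
  fix e assume e: "e \<in> exponents m (Suc r)"
  show "e \<in> {e + f | e f. e \<in> exponents m r \<and> f \<in> exponents m 1}"
  proof (cases "mdeg e \<le> r")
    case True
    then have "e \<in> exponents m r" "0 \<in> exponents m 1" "e = e + 0"
      using e by (auto simp: exponents_def)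
    then show ?thesis by blast
  next
    case False
    with e have "mdeg e = Suc r" by (simp add: exponents_def)
    then obtain i f where f: "i \<in> Poly_Mapping.keys e" "e = f + Poly_Mapping.single i 1"
      using mdeg_Suc_split by blast
    have "f \<in> exponents m r"
      using e f(2) keys_summand_subset[of f "Poly_Mapping.single i 1"]
      by (auto simp: exponents_def mdeg_add)
    moreover have "Poly_Mapping.single i 1 \<in> exponents m 1"
      using e f(1) by (auto simp: exponents_def)
    ultimately show ?thesis using f(2) by blast
  qed
next
  fix e assume "e \<in> {e + f | e f. e \<in> exponents m r \<and> f \<in> exponents m 1}"
  then show "e \<in> exponents m (Suc r)"
    using Poly_Mapping.keys_add by (fastforce simp: exponents_def mdeg_add)
qed

lemma exponents_1:
  "exponents m 1 = insert 0 ((\<lambda>i. Poly_Mapping.single i 1) ` {..<m})"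
proof (intro Set.set_eqI iffI)
  fix e assume e: "e \<in> exponents m 1"
  show "e \<in> insert 0 ((\<lambda>i. Poly_Mapping.single i 1) ` {..<m})"
  proof (cases "mdeg e = 0")
    case True
    with e have "e \<in> exponents m 0" by (simp add: exponents_def)
    then show ?thesis by (simp add: exponents_0)
  next
    case False
    with e have d: "mdeg e = Suc 0" by (simp add: exponents_def)
    then obtain i f where f: "i \<in> Poly_Mapping.keys e" "e = f + Poly_Mapping.single i 1"
      using mdeg_Suc_split by blast
    then have "f \<in> exponents m 0"
      using e d keys_summand_subset[of f "Poly_Mapping.single i 1"]
      by (auto simp: exponents_def mdeg_add)
    then have "e = Poly_Mapping.single i 1"
      using f(2) by (simp add: exponents_0)
    then show ?thesis using e f(1) by (auto simp: exponents_def)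
  qed
qed (auto simp: exponents_def)

text \<open>Evaluation turns sums of exponents into products of functions, so
  \<open>exponents_Suc\<close> becomes a recursion of the same shape as that of
  \<open>Pol\<close>.\<close>

lemma monomials_Suc:
  "monomials \<tau> m (Suc r) = {g * h | g h. g \<in> monomials \<tau> m r \<and> h \<in> monomials \<tau> m 1}"
proof -
  define M where "M = (\<lambda>e x. monomial_at (\<tau> x) e)"
  have M: "M (e + f) = M e * M f" for e f
    by (auto simp: M_def monomial_at_add)
  have "M ` {e + f | e f. e \<in> A \<and> f \<in> B} = {g * h | g h. g \<in> M ` A \<and> h \<in> M ` B}" for A B
  proof (intro subset_antisym subsetI)
    fix k assume "k \<in> M ` {e + f | e f. e \<in> A \<and> f \<in> B}"
    then obtain e f where "k = M e * M f" "e \<in> A" "f \<in> B"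
      using M by blast
    then show "k \<in> {g * h | g h. g \<in> M ` A \<and> h \<in> M ` B}"
      by blast
  next
    fix k assume "k \<in> {g * h | g h. g \<in> M ` A \<and> h \<in> M ` B}"
    then obtain e f where "k = M e * M f" "e \<in> A" "f \<in> B"
      by blast
    then show "k \<in> M ` {e + f | e f. e \<in> A \<and> f \<in> B}"
      by (intro image_eqI[of _ _ "e + f"]) (simp only: M, blast)
  qed
  then show ?thesis
    unfolding monomials_def exponents_Suc M_def .
qed

section \<open>Polynomial functions as the span of the monomials\<close>

lemma mpoly_eval_superset:
  "finite K \<Longrightarrow> Poly_Mapping.keys p \<subseteq> K \<Longrightarrow>
    mpoly_eval p v = (\<Sum>e\<in>K. Poly_Mapping.lookup p e * monomial_at v e)"
  unfolding mpoly_eval_def monomial_at_def[symmetric]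
  by (rule sum.mono_neutral_left) (auto simp: in_keys_iff)

lemma mpoly_eval_add: "mpoly_eval (p + q) v = mpoly_eval p v + mpoly_eval q v"
  using Poly_Mapping.keys_add[of p q]
  by (simp add: mpoly_eval_superset[of "Poly_Mapping.keys p \<union> Poly_Mapping.keys q"]
      lookup_add distrib_right sum.distrib)

lemma mpoly_eval_single: "mpoly_eval (Poly_Mapping.single e c) v = c * monomial_at v e"
  by (subst mpoly_eval_superset[of "{e}"]) auto

lemma mpoly_evals_eq_span:
  "{mpoly_eval f \<circ> \<tau> | f. f \<in> mpolys m r} = fun_space.span (monomials \<tau> m r)"
proof (intro Set.set_eqI iffI)
  fix h assume "h \<in> {mpoly_eval f \<circ> \<tau> | f. f \<in> mpolys m r}"
  then obtain p where p: "h = mpoly_eval p \<circ> \<tau>" "p \<in> mpolys m r" by blast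
  have "h = (\<Sum>e\<in>Poly_Mapping.keys p.
      fun_scale (Poly_Mapping.lookup p e) (\<lambda>x. monomial_at (\<tau> x) e))"
    by (auto simp: p(1) mpoly_eval_def monomial_at_def sum_fun_apply)
  also have "\<dots> \<in> fun_space.span (monomials \<tau> m r)"
    using p(2) by (intro fun_space.span_sum fun_space.span_scale fun_space.span_base)
      (auto simp: monomials_def mpolys_def exponents_def)
  finally show "h \<in> fun_space.span (monomials \<tau> m r)" .
next
  fix h assume "h \<in> fun_space.span (monomials \<tau> m r)"
  then show "h \<in> {mpoly_eval f \<circ> \<tau> | f. f \<in> mpolys m r}"
  proof (induction rule: fun_space.span_induct_alt)
    case base
    have "0 = mpoly_eval 0 \<circ> \<tau>" "0 \<in> mpolys m r"
      by (auto simp: mpoly_eval_def mpolys_def)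
    then show ?case by blast
  next
    case (step c g h)
    then obtain e p where e: "g = (\<lambda>x. monomial_at (\<tau> x) e)" "e \<in> exponents m r"
      and p: "h = mpoly_eval p \<circ> \<tau>" "p \<in> mpolys m r"
      unfolding monomials_def by blast
    \<comment> \<open>Each step of the span induction adds one term to the polynomial representing
      \<open>h\<close>; the representing polynomial need not be unique.\<close>
    have "fun_scale c g + h = mpoly_eval (Poly_Mapping.single e c + p) \<circ> \<tau>"
      by (auto simp: e(1) p(1) mpoly_eval_add mpoly_eval_single)
    moreover have "Poly_Mapping.single e c + p \<in> mpolys m r"
      using e(2) p(2) Poly_Mapping.keys_add[of "Poly_Mapping.single e c" p]
      by (auto simp: mpolys_def exponents_def split: if_splits)
    ultimately show ?case by blast
  qed
qed

section \<open>Identification of \<open>Pol\<close> with the span of the monomials\<close>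

lemma Pol_1_eq_span:
  assumes \<tau>: "\<tau> \<in> UNIV \<rightarrow> carrier_vec m" and "affinely_compatible \<tau> \<rho>"
  shows "Pol \<rho> (Suc 0) = fun_space.span (monomials \<tau> m 1)" (is "?P = ?M")
proof -
  obtain a b where "a \<noteq> 0" and \<rho>: "\<And>x y. \<rho> x y = a * (\<tau> x \<bullet> \<tau> y) + b"
    using assms(2) by (auto simp: affinely_compatible_def)
  have mon: "monomials \<tau> m 1 = insert 1 ((\<lambda>i x. \<tau> x $ i) ` {..<m})"
    unfolding monomials_def exponents_1 by (simp add: image_image one_fun_def)
  have one_M: "1 \<in> ?M" and t_M: "\<And>i. i < m \<Longrightarrow> (\<lambda>x. \<tau> x $ i) \<in> ?M"
    unfolding mon by (rule fun_space.span_base, blast)+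
  have "poly f \<circ> \<rho> y \<in> ?M" if "degree f \<le> 1" for f y
  proof -
    obtain c q where q: "f = pCons c q"
      by (cases f)
    with that have "degree q = 0"
      by (cases "q = 0") auto
    then obtain d where f: "f = [:c, d:]"
      using q degree_eq_zeroE by blast
    have dim: "dim_vec (\<tau> x) = m" for x using \<tau> by (auto dest: funcset_mem carrier_vecD)
    have "poly f \<circ> \<rho> y = fun_scale (c + d * b) 1
        + fun_scale (d * a) (\<Sum>i<m. fun_scale (\<tau> y $ i) (\<lambda>x. \<tau> x $ i))"
      by (auto simp: f \<rho> scalar_prod_def dim sum_fun_apply lessThan_atLeast0 algebra_simps)
    also have "\<dots> \<in> ?M"
      using one_M t_M
      by (intro fun_space.span_add fun_space.span_scale fun_space.span_sum) auto
    finally show ?thesis .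
  qed
  then have "?P \<subseteq> ?M"
    unfolding Pol.simps by (intro fun_space.span_minimal fun_space.subspace_span) auto
  moreover have "?M \<subseteq> ?P"
  proof -
    have gen: "poly f \<circ> \<rho> y \<in> ?P" if "degree f \<le> 1" for f y
      unfolding Pol.simps using that by (intro fun_space.span_base) blast
    have sub: "fun_space.subspace ?P"
      unfolding Pol.simps by (rule fun_space.subspace_span)
    \<comment> \<open>Here \<open>undefined\<close> is just some point of \<Omega>, which is
      nonempty because it is a type.\<close>
    have "1 = poly [:1:] \<circ> \<rho> undefined" by auto
    then have "1 \<in> ?P"
      using gen[of "[:1:]" undefined] by simp
    moreover have "(\<lambda>x. \<tau> y \<bullet> \<tau> x) \<in> ?P" for y
    proof -
      \<comment> \<open>The linear polynomial inverts the affine relation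
        \<open>\<rho> y x = a * (\<tau> y \<bullet> \<tau> x) + b\<close>, which is possible as
        \<open>a\<close> is nonzero.\<close>
      have "(\<lambda>x. \<tau> y \<bullet> \<tau> x) = poly [:- b / a, 1 / a:] \<circ> \<rho> y"
        using \<open>a \<noteq> 0\<close> by (auto simp: \<rho> field_simps)
      then show ?thesis using gen[of "[:- b / a, 1 / a:]" y] by simp
    qed
    then have "fun_space.span (range (\<lambda>y x. \<tau> y \<bullet> \<tau> x)) \<subseteq> ?P"
      by (intro fun_space.span_minimal sub) auto
    then have "(\<lambda>x. \<tau> x $ i) \<in> ?P" if "i < m" for i
      using coordinate_in_span_products[OF \<tau> that] by blast
    ultimately have "monomials \<tau> m 1 \<subseteq> ?P"
      unfolding mon by blast
    then show ?thesis
      by (intro fun_space.span_minimal sub)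
  qed
  ultimately show ?thesis by blast
qed

text \<open>From degree 1 on, both sides satisfy the same recursion: the next space is spanned by
  products with the degree-one space. \<open>Pol_1_eq_span\<close> is chained into the induction
  since it supplies the factor of degree one; constants are a separate base case.\<close>

lemma Pol_eq_span_monomials:
  assumes "\<tau> \<in> UNIV \<rightarrow> carrier_vec m" and "affinely_compatible \<tau> \<rho>"
  shows "Pol \<rho> r = fun_space.span (monomials \<tau> m r)"
  using Pol_1_eq_span[OF assms]
proof (induction \<rho> r rule: Pol.induct)
  case (1 \<rho>)
  have "monomials \<tau> m 0 = {1}"
    by (auto simp: monomials_def exponents_0 one_fun_def)
  then have "fun_space.span (monomials \<tau> m 0) = range (\<lambda>c. fun_scale c 1)"
    by (simp only: fun_space.span_singleton)
  also have "\<dots> = Pol \<rho> 0"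
    by (auto simp: fun_scale_def)
  finally show ?case by (rule sym)
next
  case (3 \<rho> r)
  then show ?case
    \<comment> \<open>Instantiating \<open>monomials_Suc\<close> at \<open>Suc r\<close> unfolds
      only one level, leaving \<open>monomials \<tau> m (Suc r)\<close> as in the induction
      hypothesis.\<close>
    by (simp only: Pol.simps(3) span_products_span monomials_Suc[of \<tau> m "Suc r"])
qed simp

theorem theorem3p1:
  fixes \<rho> :: "'a \<Rightarrow> 'a \<Rightarrow> real"
    and ip :: "('a \<Rightarrow> real) \<Rightarrow> ('a \<Rightarrow> real) \<Rightarrow> real"
    and \<tau> :: "'a \<Rightarrow> real vec"
    and n m r :: nat
  assumes "polynomial_space \<rho> ip"
    and "euclidean \<rho>"
    and "space_dim \<rho> = n"
    and "\<tau> \<in> UNIV \<rightarrow> carrier_vec m"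
    and "inj \<tau>"
    and "affinely_compatible \<tau> \<rho>"
    and "m \<ge> n"
  shows "Pol \<rho> r = {mpoly_eval f \<circ> \<tau> | f. f \<in> mpolys m r}"
  using Pol_eq_span_monomials[OF assms(4,6)] mpoly_evals_eq_span[of \<tau> m r] by simp

end
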